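(* For every integer $n\ge 0$, all real $\alpha,\beta\ge 0$, and every $x\in[-1,1]$, $$\left|g_n^{(\alpha,\beta)}(x)\right|\le \left[\frac{(n+1)(n+\alpha+\beta+1)}{(n+\alpha+1)(n+\beta+1)}\right]^{1/4}.$$
   Context: $P_n^{(\alpha,\beta)}$ is the Jacobi polynomial of degree $n$ in the standard normalization, $P_n^{(\alpha,\beta)}(1)=\frac{\Gamma(n+\alpha+1)}{n!\,\Gamma(\alpha+1)}$. The normalized weighted Jacobi function is $$g_n^{(\alpha,\beta)}(x)=\left[\frac{\Gamma(n+1)\Gamma(n+\alpha+\beta+1)}{\Gamma(n+\alpha+1)\Gamma(n+\beta+1)}\right]^{1/2}\left(\frac{1-x}{2}\right)^{\alpha/2}\left(\frac{1+x}{2}\right)^{\beta/2}P_n^{(\alpha,\beta)}(x).$$ At $x=\pm1$, powers of the form $0^0$ are understood by continuous extension in $x$ with the parameters fixed (so $0^0=1$). *)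

theory Defs
  imports "HOL-Analysis.Analysis"
begin

text \<open>
  The Jacobi polynomial as the terminating hypergeometric series
  \<open>(\<alpha>+1)\<^sub>n / n! \<cdot> F(-n, n+\<alpha>+\<beta>+1; \<alpha>+1; (1-x)/2)\<close>.
  No denominator vanishes as long as \<open>\<alpha> > -1\<close>.
\<close>

definition jacobi_P :: "nat \<Rightarrow> real \<Rightarrow> real \<Rightarrow> real \<Rightarrow> real" where
  "jacobi_P n \<alpha> \<beta> x =
     pochhammer (\<alpha> + 1) n / fact n *
     (\<Sum>k\<le>n. pochhammer (- real n) k * pochhammer (real n + \<alpha> + \<beta> + 1) k /
              (pochhammer (\<alpha> + 1) k * fact k) * ((1 - x) / 2) ^ k)"

lemma jacobi_P_at_1:
  assumes "\<alpha> > -1"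
  shows "jacobi_P n \<alpha> \<beta> 1 = Gamma (real n + \<alpha> + 1) / (fact n * Gamma (\<alpha> + 1))"
proof -
  have "\<alpha> + 1 \<notin> \<int>\<^sub>\<le>\<^sub>0"
    using assms by (auto elim!: nonpos_Ints_cases)
  then have "pochhammer (\<alpha> + 1) n = Gamma (\<alpha> + 1 + real n) / Gamma (\<alpha> + 1)"
    by (rule pochhammer_Gamma)
  moreover have "(\<Sum>k\<le>n. pochhammer (- real n) k * pochhammer (real n + \<alpha> + \<beta> + 1) k /
              (pochhammer (\<alpha> + 1) k * fact k) * ((1 - 1) / 2) ^ k) = (1::real)"
    by (subst sum.remove[of _ 0]) (auto intro!: sum.neutral)
  ultimately show ?thesis
    unfolding jacobi_P_def by (simp add: add_ac mult.commute)
qed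

text \<open>
  Real power with \<open>0\<^sup>0 = 1\<close>; the library's \<^const>\<open>powr\<close> has \<open>0 powr 0 = 0\<close>.
\<close>

definition rpow :: "real \<Rightarrow> real \<Rightarrow> real" where
  "rpow t a = (if a = 0 then 1 else t powr a)"

definition jacobi_g :: "nat \<Rightarrow> real \<Rightarrow> real \<Rightarrow> real \<Rightarrow> real" where
  "jacobi_g n \<alpha> \<beta> x =
     sqrt (Gamma (real n + 1) * Gamma (real n + \<alpha> + \<beta> + 1) /
           (Gamma (real n + \<alpha> + 1) * Gamma (real n + \<beta> + 1))) *
     rpow ((1 - x) / 2) (\<alpha> / 2) * rpow ((1 + x) / 2) (\<beta> / 2) * jacobi_P n \<alpha> \<beta> x"

end

theory Submission
  imports Defs
begin

text \<open>
  Put \<open>t = (1 - x)/2\<close> and let \<open>u\<^sub>n = g\<^sub>n\<^sup>2\<close>. By the two ladder relations between the degrees \<open>n + 1\<close> with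
  parameters \<open>(\<alpha>, \<beta>)\<close> and \<open>n\<close> with parameters \<open>(\<alpha>+1, \<beta>+1)\<close>, the energy
  \<open>V = u\<^sub>n\<^sup>(\<^sup>\<alpha>\<^sup>,\<^sup>\<beta>\<^sup>) + 2 \<Sum>\<^sub>j\<^sub>\<ge>\<^sub>1 u\<^sub>n\<^sub>-\<^sub>j\<^sup>(\<^sup>\<alpha>\<^sup>+\<^sup>j\<^sup>,\<^sup>\<beta>\<^sup>+\<^sup>j\<^sup>)\<close> telescopes to \<open>V' = u\<^sub>n \<phi>\<close> with
  \<open>\<phi> = \<alpha>/t - \<beta>/(1-t)\<close>. All \<open>2n+1\<close> summands have the same mass \<open>1/(2n+\<alpha>+\<beta>+1)\<close> on \<open>[0,1]\<close>, so
  integrating \<open>(tV)'\<close> and \<open>(t\<^sup>2V)'\<close> yields \<open>\<integral> u\<^sub>n \<alpha>/t = \<integral> u\<^sub>n \<beta>/(1-t) = 1\<close> and the mean of \<open>t\<close>.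
  If \<open>\<alpha>, \<beta> > 0\<close>, then \<open>V\<close> vanishes at both ends, hence \<open>2V \<le> \<integral> u\<^sub>n \<bar>\<phi>\<bar>\<close>, and the Cauchy-Schwarz
  inequality with weight \<open>\<alpha>/t + \<beta>/(1-t)\<close>, followed by Jensen's inequality, bounds this by twice the
  square of the right-hand side. If \<open>\<alpha> = 0\<close> or \<open>\<beta> = 0\<close>, then \<open>V\<close> is monotone with maximum 1.
\<close>

section \<open>Jacobi polynomials in the variable \<open>t = (1 - x) / 2\<close>\<close>

text \<open>No bound on \<open>k\<close> is imposed: \<open>pochhammer (- real n) k\<close> vanishes
  for k > n, so the coefficient identities below hold for every index without case
  distinction.\<close>

definition jacobi_coeff :: "nat \<Rightarrow> real \<Rightarrow> real \<Rightarrow> nat \<Rightarrow> real" where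
  "jacobi_coeff n \<alpha> \<beta> k = pochhammer (\<alpha> + 1) n / fact n *
     (pochhammer (- real n) k * pochhammer (real n + \<alpha> + \<beta> + 1) k / (pochhammer (\<alpha> + 1) k * fact k))"

definition jacobi_poly :: "nat \<Rightarrow> real \<Rightarrow> real \<Rightarrow> real poly" where
  "jacobi_poly n \<alpha> \<beta> = (\<Sum>k\<le>n. monom (jacobi_coeff n \<alpha> \<beta> k) k)"

lemma coeff_jacobi_poly: "coeff (jacobi_poly n \<alpha> \<beta>) k = jacobi_coeff n \<alpha> \<beta> k"
proof (cases "k \<le> n")
  case False
  then have "jacobi_coeff n \<alpha> \<beta> k = 0"
    by (simp add: jacobi_coeff_def pochhammer_of_nat_eq_0_lemma)
  with False show ?thesis
    by (simp add: jacobi_poly_def coeff_sum)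
qed (simp add: jacobi_poly_def coeff_sum)

lemma poly_jacobi_poly: "poly (jacobi_poly n \<alpha> \<beta>) ((1 - x) / 2) = jacobi_P n \<alpha> \<beta> x"
  by (simp add: jacobi_poly_def jacobi_P_def jacobi_coeff_def poly_sum poly_monom
      sum_distrib_left mult.assoc)

text \<open>The term ratio of the hypergeometric series, cleared of denominators; it is the Jacobi
  differential equation read coefficientwise.\<close>

lemma jacobi_coeff_Suc:
  assumes "\<alpha> \<ge> 0"
  shows "(real k + 1) * (real k + \<alpha> + 1) * jacobi_coeff n \<alpha> \<beta> (Suc k) =
    (real k - real n) * (real k + real n + \<alpha> + \<beta> + 1) * jacobi_coeff n \<alpha> \<beta> k"
proof -
  have nz: "pochhammer (\<alpha> + 1) k \<noteq> 0" "\<alpha> + 1 + real k \<noteq> 0" "(1 + real k) \<noteq> 0"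
    using assms pochhammer_pos[of "\<alpha> + 1" k] by auto
  have *: "c * (d * p * (e * q) / (r * f * (g * s))) * (g * f) = c * (p * q / (r * s)) * (d * e)"
    if "f \<noteq> 0" "g \<noteq> 0" for c d p e q r f g s :: real
    using that by (simp add: field_simps)
  have "jacobi_coeff n \<alpha> \<beta> (Suc k) * ((1 + real k) * (\<alpha> + 1 + real k)) =
      jacobi_coeff n \<alpha> \<beta> k * ((- real n + real k) * (real n + \<alpha> + \<beta> + 1 + real k))"
    unfolding jacobi_coeff_def pochhammer_Suc fact_Suc
    using *[OF nz(2,3)] by (simp add: mult_ac)
  then show ?thesis
    by (simp add: algebra_simps)
qed

text \<open>Differentiating a hypergeometric series raises all of its parameters by one. Here
  -(n+1), n+\<alpha>+\<beta>+2, \<alpha>+1 become those of degree n with parameters \<alpha>+1,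
  \<beta>+1. This is the lowering ladder relation.\<close>

lemma jacobi_coeff_shift:
  assumes "\<alpha> \<ge> 0"
  shows "(real k + 1) * jacobi_coeff (Suc n) \<alpha> \<beta> (Suc k) =
    - (real n + \<alpha> + \<beta> + 2) * jacobi_coeff n (\<alpha> + 1) (\<beta> + 1) k"
proof -
  have *: "k1 * (a * p / (n1 * f) * (- n1 * q * (m * r) / (a * s * (k1 * g)))) = - m * (p / f * (q * r / (s * g)))"
    if "a \<noteq> 0" "n1 \<noteq> 0" "k1 \<noteq> 0" for a p n1 f q m r s k1 g :: real
    using that by (simp add: field_simps)
  have e: "- real (Suc n) + 1 = - real n"
    "real n + (\<alpha> + 1) + (\<beta> + 1) + 1 = real n + \<alpha> + \<beta> + 2 + 1"
    "real (Suc n) + \<alpha> + \<beta> + 1 = real n + \<alpha> + \<beta> + 2" "real k + 1 = real (Suc k)"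
    by auto
  show ?thesis
    unfolding jacobi_coeff_def pochhammer_rec fact_Suc e of_nat_mult
    using assms by (intro *) auto
qed

lemma pderiv_jacobi_poly:
  assumes "\<alpha> \<ge> 0"
  shows "pderiv (jacobi_poly (Suc n) \<alpha> \<beta>) =
    smult (- (real n + \<alpha> + \<beta> + 2)) (jacobi_poly n (\<alpha> + 1) (\<beta> + 1))"
  using jacobi_coeff_shift[OF assms]
  by (simp add: poly_eq_iff coeff_pderiv coeff_jacobi_poly add.commute)

text \<open>The raising ladder relation, one step of Rodrigues' formula: after multiplication by
  t^\<alpha> (1-t)^\<beta>, the left side is the derivative of t^(\<alpha>+1) (1-t)^(\<beta>+1)
  times the polynomial of degree n. It is proved by comparing coefficients.\<close>

lemma jacobi_poly_raise:
  assumes "\<alpha> \<ge> 0" "\<beta> \<ge> 0"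
  shows "t * (1 - t) * poly (pderiv (jacobi_poly n (\<alpha> + 1) (\<beta> + 1))) t +
      ((\<alpha> + 1) * (1 - t) - (\<beta> + 1) * t) * poly (jacobi_poly n (\<alpha> + 1) (\<beta> + 1)) t =
    (real n + 1) * poly (jacobi_poly (Suc n) \<alpha> \<beta>) t"
proof -
  let ?p = "jacobi_poly n (\<alpha> + 1) (\<beta> + 1)"
  let ?b = "jacobi_coeff n (\<alpha> + 1) (\<beta> + 1)" and ?q = "jacobi_coeff (Suc n) \<alpha> \<beta>"
  define m where "m = real n + \<alpha> + \<beta> + 2"
  have m: "m > 0" using assms by (simp add: m_def)
  have shift: "(real k + 1) * ?q (Suc k) = - m * ?b k" for k
    using jacobi_coeff_shift[OF assms(1)] by (simp add: m_def)
  \<comment> \<open>Eliminating \<open>?q (Suc k)\<close> between the term ratio and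
    \<open>shift\<close> relates the two families at the same index.\<close>
  have ratio: "(real k + \<alpha> + 1) * (m * ?b k) = (real n + 1 - real k) * (real k + m) * ?q k" for k
  proof -
    have "(real k + \<alpha> + 1) * ((real k + 1) * ?q (Suc k)) =
        (real k - (real n + 1)) * (real k + m) * ?q k"
      using jacobi_coeff_Suc[OF assms(1), of k "Suc n" \<beta>] by (simp add: m_def mult_ac add_ac)
    then show ?thesis
      unfolding shift by algebra
  qed
  have "pCons 0 (pderiv ?p - pCons 0 (pderiv ?p)) + smult (\<alpha> + 1) ?p
      - smult (\<alpha> + \<beta> + 2) (pCons 0 ?p) = smult (real n + 1) (jacobi_poly (Suc n) \<alpha> \<beta>)"
  proof (rule poly_eqI)
    fix k
    show "coeff (pCons 0 (pderiv ?p - pCons 0 (pderiv ?p)) + smult (\<alpha> + 1) ?p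
      - smult (\<alpha> + \<beta> + 2) (pCons 0 ?p)) k = coeff (smult (real n + 1) (jacobi_poly (Suc n) \<alpha> \<beta>)) k"
    proof (cases k)
      case 0
      then show ?thesis
        using ratio[of 0] m by (simp add: coeff_jacobi_poly)
    next
      case (Suc j)
      \<comment> \<open>Both \<open>ratio\<close> and \<open>shift\<close> express m times a
        coefficient \<open>?b\<close> through \<open>?q (Suc j)\<close>, so the claim is checked
        with the factor m and then cancelled.\<close>
      have "m * ((real j + 1 + (\<alpha> + 1)) * ?b (Suc j) - (real j + \<alpha> + \<beta> + 2) * ?b j) =
          m * ((real n + 1) * ?q (Suc j))"
        using ratio[of "Suc j"] shift[of j] unfolding m_def by simp algebra
      then have "(real j + 1 + (\<alpha> + 1)) * ?b (Suc j) - (real j + \<alpha> + \<beta> + 2) * ?b j =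
          (real n + 1) * ?q (Suc j)"
        using m by simp
      then show ?thesis
        by (simp add: Suc coeff_jacobi_poly coeff_pderiv coeff_pCons algebra_simps split: nat.splits)
    qed
  qed
  from arg_cong[OF this, of "\<lambda>p. poly p t"] show ?thesis
    by (simp add: algebra_simps)
qed

section \<open>The squared Jacobi functions\<close>

definition jacobi_weight :: "real \<Rightarrow> real \<Rightarrow> real \<Rightarrow> real" where
  "jacobi_weight \<alpha> \<beta> t = rpow t \<alpha> * rpow (1 - t) \<beta>"

text \<open>The orthonormal normalization would carry an additional factor 2n+\<alpha>+\<beta>+1;
  its absence makes the mass of the square 1/(2n+\<alpha>+\<beta>+1).\<close>

definition jacobi_norm :: "nat \<Rightarrow> real \<Rightarrow> real \<Rightarrow> real" where
  "jacobi_norm n \<alpha> \<beta> = Gamma (real n + 1) * Gamma (real n + \<alpha> + \<beta> + 1) /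
     (Gamma (real n + \<alpha> + 1) * Gamma (real n + \<beta> + 1))"

definition jacobi_sq :: "nat \<Rightarrow> real \<Rightarrow> real \<Rightarrow> real \<Rightarrow> real" where
  "jacobi_sq n \<alpha> \<beta> t = jacobi_norm n \<alpha> \<beta> * jacobi_weight \<alpha> \<beta> t * (poly (jacobi_poly n \<alpha> \<beta>) t)\<^sup>2"

lemma rpow_nonneg: "t \<ge> 0 \<Longrightarrow> rpow t a \<ge> 0"
  by (simp add: rpow_def)

lemma rpow_half_square: "t \<ge> 0 \<Longrightarrow> (rpow t (a / 2))\<^sup>2 = rpow t a"
  by (simp add: rpow_def power2_eq_square flip: powr_add)

lemma rpow_add_1: "t \<ge> 0 \<Longrightarrow> a \<ge> 0 \<Longrightarrow> rpow t (a + 1) = t * rpow t a"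
  by (cases "t = 0") (auto simp: rpow_def powr_add)

lemma continuous_on_rpow:
  assumes "a \<ge> 0" "continuous_on S f" "\<And>t. t \<in> S \<Longrightarrow> f t \<ge> 0"
  shows "continuous_on S (\<lambda>t. rpow (f t) a)"
proof (cases "a = 0")
  case False
  with assms have "continuous_on S (\<lambda>t. f t powr a)"
    by (intro continuous_on_powr') auto
  with False show ?thesis by (simp add: rpow_def)
qed (simp add: rpow_def)

lemma has_real_derivative_rpow:
  assumes "t > 0"
  shows "((\<lambda>t. rpow t a) has_real_derivative rpow t a * (a / t)) (at t)"
  using assms has_real_derivative_powr[OF assms, of a]
  by (cases "a = 0") (auto simp: rpow_def powr_diff mult_ac)

lemma jacobi_norm_pos: "\<alpha> \<ge> 0 \<Longrightarrow> \<beta> \<ge> 0 \<Longrightarrow> jacobi_norm n \<alpha> \<beta> > 0"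
  unfolding jacobi_norm_def by (intro divide_pos_pos mult_pos_pos Gamma_real_pos) auto

lemma Gamma_real_plus1: "x > 0 \<Longrightarrow> Gamma (x + 1) = x * Gamma (x :: real)"
  by (rule Gamma_plus1) (auto elim!: nonpos_Ints_cases)

text \<open>Balances the constant n+1 of the raising relation against n+\<alpha>+\<beta>+2 of the
  lowering one. This makes the cross terms cancel later and the ladder step preserve mass.\<close>

lemma jacobi_norm_shift:
  assumes "\<alpha> \<ge> 0" "\<beta> \<ge> 0"
  shows "jacobi_norm n (\<alpha> + 1) (\<beta> + 1) * (real n + 1) =
    jacobi_norm (Suc n) \<alpha> \<beta> * (real n + \<alpha> + \<beta> + 2)"
proof -
  have 1: "Gamma (real (Suc n) + 1) = (real n + 1) * Gamma (real n + 1)"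
    using Gamma_real_plus1[of "real n + 1"] by (simp add: add_ac)
  have 2: "Gamma (real n + (\<alpha> + 1) + (\<beta> + 1) + 1) =
      (real n + \<alpha> + \<beta> + 2) * Gamma (real (Suc n) + \<alpha> + \<beta> + 1)"
    using Gamma_real_plus1[of "real n + \<alpha> + \<beta> + 2"] assms by (simp add: add_ac)
  show ?thesis
    unfolding jacobi_norm_def 1 2 by (simp add: add_ac)
qed

lemma jacobi_weight_shift:
  assumes "\<alpha> \<ge> 0" "\<beta> \<ge> 0" "t \<in> {0..1}"
  shows "jacobi_weight (\<alpha> + 1) (\<beta> + 1) t = t * (1 - t) * jacobi_weight \<alpha> \<beta> t"
  using assms by (simp add: jacobi_weight_def rpow_add_1)

lemma has_real_derivative_jacobi_weight:
  assumes "t \<in> {0<..<1}"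
  shows "(jacobi_weight \<alpha> \<beta> has_real_derivative
    jacobi_weight \<alpha> \<beta> t * (\<alpha> / t - \<beta> / (1 - t))) (at t)"
proof -
  have "((\<lambda>t. rpow (1 - t) \<beta>) has_real_derivative (rpow (1 - t) \<beta> * (\<beta> / (1 - t))) * (-1)) (at t)"
    using assms by (intro DERIV_chain2[OF has_real_derivative_rpow]) (auto intro!: derivative_eq_intros)
  moreover have "((\<lambda>t. rpow t \<alpha>) has_real_derivative rpow t \<alpha> * (\<alpha> / t)) (at t)"
    using assms by (intro has_real_derivative_rpow) auto
  ultimately have "((\<lambda>t. rpow t \<alpha> * rpow (1 - t) \<beta>) has_real_derivative
      jacobi_weight \<alpha> \<beta> t * (\<alpha> / t - \<beta> / (1 - t))) (at t)"
    by (auto intro!: derivative_eq_intros simp: jacobi_weight_def algebra_simps)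
  then show ?thesis
    unfolding jacobi_weight_def[abs_def] .
qed

lemma continuous_on_jacobi_weight:
  "\<alpha> \<ge> 0 \<Longrightarrow> \<beta> \<ge> 0 \<Longrightarrow> continuous_on {0..1} (jacobi_weight \<alpha> \<beta>)"
  unfolding jacobi_weight_def[abs_def]
  by (intro continuous_intros continuous_on_rpow) auto

lemma continuous_on_jacobi_sq:
  "\<alpha> \<ge> 0 \<Longrightarrow> \<beta> \<ge> 0 \<Longrightarrow> continuous_on {0..1} (jacobi_sq n \<alpha> \<beta>)"
  unfolding jacobi_sq_def[abs_def]
  by (intro continuous_intros continuous_on_jacobi_weight) auto

lemma jacobi_sq_nonneg: "\<alpha> \<ge> 0 \<Longrightarrow> \<beta> \<ge> 0 \<Longrightarrow> t \<in> {0..1} \<Longrightarrow> jacobi_sq n \<alpha> \<beta> t \<ge> 0"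
  using jacobi_norm_pos[of \<alpha> \<beta> n] by (simp add: jacobi_sq_def jacobi_weight_def rpow_nonneg)

lemma jacobi_sq_0: "\<alpha> > 0 \<Longrightarrow> jacobi_sq n \<alpha> \<beta> 0 = 0"
  by (simp add: jacobi_sq_def jacobi_weight_def rpow_def)

lemma jacobi_sq_1: "\<beta> > 0 \<Longrightarrow> jacobi_sq n \<alpha> \<beta> 1 = 0"
  by (simp add: jacobi_sq_def jacobi_weight_def rpow_def)

lemma jacobi_g_square:
  assumes "\<alpha> \<ge> 0" "\<beta> \<ge> 0" "x \<in> {-1..1}"
  shows "(jacobi_g n \<alpha> \<beta> x)\<^sup>2 = jacobi_sq n \<alpha> \<beta> ((1 - x) / 2)"
proof -
  have 1: "1 - (1 - x) / 2 = (1 + x) / 2" by (simp add: field_simps)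
  have "sqrt (jacobi_norm n \<alpha> \<beta>) ^ 2 = jacobi_norm n \<alpha> \<beta>"
    using jacobi_norm_pos[OF assms(1,2), of n] by simp
  then show ?thesis
    using assms unfolding jacobi_g_def jacobi_sq_def jacobi_weight_def poly_jacobi_poly 1
    by (simp add: power_mult_distrib rpow_half_square flip: jacobi_norm_def)
qed

section \<open>Derivatives of the squares through the ladder relations\<close>

lemma has_real_derivative_jacobi_sq:
  assumes "t \<in> {0<..<1}"
  shows "(jacobi_sq n \<alpha> \<beta> has_real_derivative
    jacobi_sq n \<alpha> \<beta> t * (\<alpha> / t - \<beta> / (1 - t)) +
    2 * jacobi_norm n \<alpha> \<beta> * jacobi_weight \<alpha> \<beta> t *
      poly (jacobi_poly n \<alpha> \<beta>) t * poly (pderiv (jacobi_poly n \<alpha> \<beta>)) t) (at t)"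
proof -
  let ?p = "poly (jacobi_poly n \<alpha> \<beta>)"
  have "jacobi_sq n \<alpha> \<beta> = (\<lambda>t. jacobi_norm n \<alpha> \<beta> * (jacobi_weight \<alpha> \<beta> t * (?p t * ?p t)))"
    by (simp add: jacobi_sq_def fun_eq_iff power2_eq_square)
  then show ?thesis
    using DERIV_cmult[OF DERIV_mult[OF has_real_derivative_jacobi_weight[OF assms, of \<alpha> \<beta>]
          DERIV_mult[OF poly_DERIV[of "jacobi_poly n \<alpha> \<beta>"] poly_DERIV[of "jacobi_poly n \<alpha> \<beta>"]]],
        of "jacobi_norm n \<alpha> \<beta>"]
    by (simp add: mult_ac distrib_left)
qed

text \<open>The lowering relation replaces the derivative of the polynomial by its ladder neighbour.
  The resulting cross term reappears with opposite sign in
  \<open>has_real_derivative_jacobi_sq_shift\<close>.\<close>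

lemma has_real_derivative_jacobi_sq_Suc:
  assumes "\<alpha> \<ge> 0" "t \<in> {0<..<1}"
  shows "(jacobi_sq (Suc n) \<alpha> \<beta> has_real_derivative
    jacobi_sq (Suc n) \<alpha> \<beta> t * (\<alpha> / t - \<beta> / (1 - t)) -
    2 * jacobi_norm (Suc n) \<alpha> \<beta> * (real n + \<alpha> + \<beta> + 2) * jacobi_weight \<alpha> \<beta> t *
      poly (jacobi_poly (Suc n) \<alpha> \<beta>) t * poly (jacobi_poly n (\<alpha> + 1) (\<beta> + 1)) t) (at t)"
  by (rule DERIV_cong[OF has_real_derivative_jacobi_sq[OF assms(2)]])
    (simp add: pderiv_jacobi_poly[OF assms(1)] algebra_simps)

text \<open>The raising relation times the weight, solved for the derivative so that it can be
  substituted directly.\<close>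

lemma jacobi_weight_raise:
  assumes "\<alpha> \<ge> 0" "\<beta> \<ge> 0" "t \<in> {0<..<1}"
  shows "jacobi_weight (\<alpha> + 1) (\<beta> + 1) t * poly (pderiv (jacobi_poly n (\<alpha> + 1) (\<beta> + 1))) t =
    (real n + 1) * jacobi_weight \<alpha> \<beta> t * poly (jacobi_poly (Suc n) \<alpha> \<beta>) t -
    jacobi_weight (\<alpha> + 1) (\<beta> + 1) t * ((\<alpha> + 1) / t - (\<beta> + 1) / (1 - t)) *
      poly (jacobi_poly n (\<alpha> + 1) (\<beta> + 1)) t"
proof -
  define \<phi> where "\<phi> = (\<alpha> + 1) / t - (\<beta> + 1) / (1 - t)"
  have "t * (1 - t) * \<phi> = (\<alpha> + 1) * (1 - t) - (\<beta> + 1) * t"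
    using assms by (simp add: \<phi>_def field_simps)
  moreover have "jacobi_weight (\<alpha> + 1) (\<beta> + 1) t = t * (1 - t) * jacobi_weight \<alpha> \<beta> t"
    using assms by (simp add: jacobi_weight_shift)
  ultimately show ?thesis
    using jacobi_poly_raise[OF assms(1,2), of t n] unfolding \<phi>_def[symmetric] by algebra
qed

text \<open>The weight contributes the square times its logarithmic derivative once, and the raising
  relation subtracts this twice; hence the reversed sign compared with
  \<open>has_real_derivative_jacobi_sq_Suc\<close>.\<close>

lemma has_real_derivative_jacobi_sq_shift:
  assumes "\<alpha> \<ge> 0" "\<beta> \<ge> 0" "t \<in> {0<..<1}"
  shows "(jacobi_sq n (\<alpha> + 1) (\<beta> + 1) has_real_derivative
    2 * jacobi_norm (Suc n) \<alpha> \<beta> * (real n + \<alpha> + \<beta> + 2) * jacobi_weight \<alpha> \<beta> t *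
      poly (jacobi_poly (Suc n) \<alpha> \<beta>) t * poly (jacobi_poly n (\<alpha> + 1) (\<beta> + 1)) t -
    jacobi_sq n (\<alpha> + 1) (\<beta> + 1) t * ((\<alpha> + 1) / t - (\<beta> + 1) / (1 - t))) (at t)"
proof (rule DERIV_cong[OF has_real_derivative_jacobi_sq[OF assms(3)]])
  define \<phi> where "\<phi> = (\<alpha> + 1) / t - (\<beta> + 1) / (1 - t)"
  show "jacobi_sq n (\<alpha> + 1) (\<beta> + 1) t * ((\<alpha> + 1) / t - (\<beta> + 1) / (1 - t)) +
      2 * jacobi_norm n (\<alpha> + 1) (\<beta> + 1) * jacobi_weight (\<alpha> + 1) (\<beta> + 1) t *
        poly (jacobi_poly n (\<alpha> + 1) (\<beta> + 1)) t *
        poly (pderiv (jacobi_poly n (\<alpha> + 1) (\<beta> + 1))) t =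
      2 * jacobi_norm (Suc n) \<alpha> \<beta> * (real n + \<alpha> + \<beta> + 2) * jacobi_weight \<alpha> \<beta> t *
        poly (jacobi_poly (Suc n) \<alpha> \<beta>) t * poly (jacobi_poly n (\<alpha> + 1) (\<beta> + 1)) t -
      jacobi_sq n (\<alpha> + 1) (\<beta> + 1) t * ((\<alpha> + 1) / t - (\<beta> + 1) / (1 - t))"
    using jacobi_weight_raise[OF assms, of n] jacobi_norm_shift[OF assms(1,2), of n]
    unfolding jacobi_sq_def \<phi>_def[symmetric] by algebra
qed

text \<open>Raising both parameters while lowering the degree is unitary: this is integration by parts,
  since the two ladder relations are adjoint to each other.\<close>

lemma has_integral_jacobi_sq:
  assumes "\<alpha> \<ge> 0" "\<beta> \<ge> 0"
  shows "(jacobi_sq n \<alpha> \<beta> has_integral 1 / (2 * real n + \<alpha> + \<beta> + 1)) {0..1}"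
  using assms
proof (induction n arbitrary: \<alpha> \<beta>)
  case 0
  have "((\<lambda>t. t powr (\<alpha> + 1 - 1) * (1 - t) powr (\<beta> + 1 - 1)) has_integral Beta (\<alpha> + 1) (\<beta> + 1)) {0..1}"
    using 0 by (intro has_integral_Beta_real) auto
  \<comment> \<open>\<open>powr\<close> and \<open>rpow\<close> can differ only at the endpoints,
    when a parameter is 0.\<close>
  then have "(jacobi_weight \<alpha> \<beta> has_integral Beta (\<alpha> + 1) (\<beta> + 1)) {0..1}"
    by (rule has_integral_spike_finite[rotated 2, of _ _ _ "{0, 1}"])
      (auto simp: jacobi_weight_def rpow_def)
  then have *: "((\<lambda>t. jacobi_norm 0 \<alpha> \<beta> * jacobi_weight \<alpha> \<beta> t) has_integral
      jacobi_norm 0 \<alpha> \<beta> * Beta (\<alpha> + 1) (\<beta> + 1)) {0..1}"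
    by (rule has_integral_mult_right)
  have "Gamma (\<alpha> + \<beta> + 2) = (\<alpha> + \<beta> + 1) * Gamma (\<alpha> + \<beta> + 1)"
    using Gamma_real_plus1[of "\<alpha> + \<beta> + 1"] 0 by (simp add: add_ac)
  moreover have "Gamma (\<alpha> + 1) > 0" "Gamma (\<beta> + 1) > 0" "Gamma (\<alpha> + \<beta> + 1) > 0"
    using 0 by (auto intro!: Gamma_real_pos)
  ultimately have "jacobi_norm 0 \<alpha> \<beta> * Beta (\<alpha> + 1) (\<beta> + 1) = 1 / (\<alpha> + \<beta> + 1)"
    by (simp add: jacobi_norm_def Beta_def add_ac)
  moreover have "jacobi_sq 0 \<alpha> \<beta> = (\<lambda>t. jacobi_norm 0 \<alpha> \<beta> * jacobi_weight \<alpha> \<beta> t)"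
    by (simp add: jacobi_sq_def fun_eq_iff jacobi_poly_def jacobi_coeff_def monom_0)
  ultimately show ?case
    using * by simp
next
  case (Suc n)
  note nonneg = Suc.prems
  \<comment> \<open>This c turns both c (n+1) and c m into normalizations, so the derivative of G is
    exactly the difference of the two squares. G is the boundary term of the integration by parts
    and vanishes at both ends through the factor t (1-t) of its weight.\<close>
  define c where "c = jacobi_norm (Suc n) \<alpha> \<beta> / (real n + 1)"
  define G where "G = (\<lambda>t. c * (jacobi_weight (\<alpha> + 1) (\<beta> + 1) t *
    poly (jacobi_poly n (\<alpha> + 1) (\<beta> + 1)) t * poly (jacobi_poly (Suc n) \<alpha> \<beta>) t))"
  have "((\<lambda>t. jacobi_sq (Suc n) \<alpha> \<beta> t - jacobi_sq n (\<alpha> + 1) (\<beta> + 1) t) has_integral (G 1 - G 0)) {0..1}"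
  proof (rule fundamental_theorem_of_calculus_interior)
    show "continuous_on {0..1} G"
      unfolding G_def using nonneg by (intro continuous_intros continuous_on_jacobi_weight) auto
    fix t :: real assume t: "t \<in> {0<..<1}"
    define \<phi> where "\<phi> = (\<alpha> + 1) / t - (\<beta> + 1) / (1 - t)"
    define m where "m = real n + \<alpha> + \<beta> + 2"
    let ?Q = "poly (jacobi_poly (Suc n) \<alpha> \<beta>) t"
    let ?R = "poly (jacobi_poly n (\<alpha> + 1) (\<beta> + 1)) t"
    let ?w = "jacobi_weight (\<alpha> + 1) (\<beta> + 1) t"
    have "(G has_real_derivative c * (real n + 1) * jacobi_weight \<alpha> \<beta> t * ?Q\<^sup>2 - c * m * ?w * ?R\<^sup>2) (at t)"
      unfolding G_def
    proof (rule DERIV_cong[OF DERIV_cmult[OF DERIV_mult[OF DERIV_mult[OF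
              has_real_derivative_jacobi_weight[OF t] poly_DERIV] poly_DERIV]]])
      show "c * ((?w * ((\<alpha> + 1) / t - (\<beta> + 1) / (1 - t)) * ?R +
            poly (pderiv (jacobi_poly n (\<alpha> + 1) (\<beta> + 1))) t * ?w) * ?Q +
          poly (pderiv (jacobi_poly (Suc n) \<alpha> \<beta>)) t * (?w * ?R)) =
        c * (real n + 1) * jacobi_weight \<alpha> \<beta> t * ?Q\<^sup>2 - c * m * ?w * ?R\<^sup>2"
        using jacobi_weight_raise[OF nonneg t, of n]
        unfolding pderiv_jacobi_poly[OF nonneg(1)] poly_smult m_def[symmetric] \<phi>_def[symmetric]
        by algebra
    qed
    moreover have "c * (real n + 1) = jacobi_norm (Suc n) \<alpha> \<beta>"
      by (simp add: c_def)
    moreover have "c * m = jacobi_norm n (\<alpha> + 1) (\<beta> + 1)"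
      using jacobi_norm_shift[OF nonneg, of n] by (simp add: c_def m_def field_simps)
    ultimately show "(G has_vector_derivative
        jacobi_sq (Suc n) \<alpha> \<beta> t - jacobi_sq n (\<alpha> + 1) (\<beta> + 1) t) (at t)"
      by (simp add: jacobi_sq_def has_real_derivative_iff_has_vector_derivative)
  qed simp
  moreover have "G 1 = 0" "G 0 = 0"
    using nonneg by (simp_all add: G_def jacobi_weight_shift)
  moreover have "(jacobi_sq n (\<alpha> + 1) (\<beta> + 1) has_integral
      1 / (2 * real n + (\<alpha> + 1) + (\<beta> + 1) + 1)) {0..1}"
    using Suc.IH[of "\<alpha> + 1" "\<beta> + 1"] nonneg by simp
  ultimately have "((\<lambda>t. jacobi_sq (Suc n) \<alpha> \<beta> t - jacobi_sq n (\<alpha> + 1) (\<beta> + 1) t +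
      jacobi_sq n (\<alpha> + 1) (\<beta> + 1) t) has_integral (0 - 0) + 1 / (2 * real n + (\<alpha> + 1) + (\<beta> + 1) + 1)) {0..1}"
    by (intro has_integral_add) simp_all
  then show ?case
    by (simp add: algebra_simps)
qed

section \<open>The energy and its moments\<close>

text \<open>The factor 2 of the sum V is encoded by the recursion: each lower square occurs once
  explicitly and once more as the head of the recursive call.\<close>

fun jacobi_energy :: "nat \<Rightarrow> real \<Rightarrow> real \<Rightarrow> real \<Rightarrow> real" where
  "jacobi_energy 0 \<alpha> \<beta> t = jacobi_sq 0 \<alpha> \<beta> t"
| "jacobi_energy (Suc n) \<alpha> \<beta> t =
     jacobi_sq (Suc n) \<alpha> \<beta> t + jacobi_sq n (\<alpha> + 1) (\<beta> + 1) t + jacobi_energy n (\<alpha> + 1) (\<beta> + 1) t"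

lemma jacobi_energy_nonneg:
  "\<alpha> \<ge> 0 \<Longrightarrow> \<beta> \<ge> 0 \<Longrightarrow> t \<in> {0..1} \<Longrightarrow> jacobi_energy n \<alpha> \<beta> t \<ge> 0"
  by (induction n arbitrary: \<alpha> \<beta>) (simp_all add: jacobi_sq_nonneg)

lemma jacobi_sq_le_energy:
  assumes "\<alpha> \<ge> 0" "\<beta> \<ge> 0" "t \<in> {0..1}"
  shows "jacobi_sq n \<alpha> \<beta> t \<le> jacobi_energy n \<alpha> \<beta> t"
  using assms jacobi_sq_nonneg[of "\<alpha> + 1" "\<beta> + 1" t] jacobi_energy_nonneg[of "\<alpha> + 1" "\<beta> + 1" t]
  by (cases n) (simp_all add: add_nonneg_nonneg add.assoc)

lemma jacobi_energy_0: "\<alpha> > 0 \<Longrightarrow> jacobi_energy n \<alpha> \<beta> 0 = 0"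
  by (induction n arbitrary: \<alpha> \<beta>) (simp_all add: jacobi_sq_0)

lemma jacobi_energy_1: "\<beta> > 0 \<Longrightarrow> jacobi_energy n \<alpha> \<beta> 1 = 0"
  by (induction n arbitrary: \<alpha> \<beta>) (simp_all add: jacobi_sq_1)

lemma continuous_on_jacobi_energy:
  "\<alpha> \<ge> 0 \<Longrightarrow> \<beta> \<ge> 0 \<Longrightarrow> continuous_on {0..1} (jacobi_energy n \<alpha> \<beta>)"
proof (induction n arbitrary: \<alpha> \<beta>)
  case (Suc n)
  then show ?case
    unfolding jacobi_energy.simps(2)[abs_def]
    by (intro continuous_intros continuous_on_jacobi_sq Suc.IH) auto
qed (simp add: continuous_on_jacobi_sq[unfolded jacobi_energy.simps(1)[symmetric]])

text \<open>The cross terms of neighbouring summands cancel, so only the leading square survives.\<close>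

lemma has_real_derivative_jacobi_energy:
  assumes "\<alpha> \<ge> 0" "\<beta> \<ge> 0" "t \<in> {0<..<1}"
  shows "(jacobi_energy n \<alpha> \<beta> has_real_derivative
    jacobi_sq n \<alpha> \<beta> t * (\<alpha> / t - \<beta> / (1 - t))) (at t)"
  using assms
proof (induction n arbitrary: \<alpha> \<beta>)
  case 0
  have "jacobi_energy 0 \<alpha> \<beta> = jacobi_sq 0 \<alpha> \<beta>"
    by (simp add: fun_eq_iff)
  moreover have "pderiv (jacobi_poly 0 \<alpha> \<beta>) = 0"
    by (simp add: jacobi_poly_def monom_0 pderiv_pCons)
  ultimately show ?case
    using has_real_derivative_jacobi_sq[OF 0(3), of 0 \<alpha> \<beta>] by simp
next
  case (Suc n)
  have eq: "jacobi_energy (Suc n) \<alpha> \<beta> = (\<lambda>t. jacobi_sq (Suc n) \<alpha> \<beta> t +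
      jacobi_sq n (\<alpha> + 1) (\<beta> + 1) t + jacobi_energy n (\<alpha> + 1) (\<beta> + 1) t)"
    by (simp add: fun_eq_iff)
  have "(jacobi_energy n (\<alpha> + 1) (\<beta> + 1) has_real_derivative
      jacobi_sq n (\<alpha> + 1) (\<beta> + 1) t * ((\<alpha> + 1) / t - (\<beta> + 1) / (1 - t))) (at t)"
    using Suc by simp
  from DERIV_add[OF DERIV_add[OF has_real_derivative_jacobi_sq_Suc[OF Suc.prems(1,3), of n \<beta>]
        has_real_derivative_jacobi_sq_shift[OF Suc.prems, of n]] this]
  show ?case
    unfolding eq by (simp only: diff_add_cancel add_diff_eq)
qed

text \<open>A ladder step leaves 2n+\<alpha>+\<beta> unchanged, so all 2n+1 summands have equal
  mass.\<close>

lemma has_integral_jacobi_energy: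
  "\<alpha> \<ge> 0 \<Longrightarrow> \<beta> \<ge> 0 \<Longrightarrow>
    (jacobi_energy n \<alpha> \<beta> has_integral (2 * real n + 1) / (2 * real n + \<alpha> + \<beta> + 1)) {0..1}"
proof (induction n arbitrary: \<alpha> \<beta>)
  case 0
  then show ?case
    using has_integral_jacobi_sq[of \<alpha> \<beta> 0] by (simp add: jacobi_energy.simps(1)[abs_def])
next
  case (Suc n)
  have "(jacobi_energy (Suc n) \<alpha> \<beta> has_integral
      1 / (2 * real (Suc n) + \<alpha> + \<beta> + 1) + 1 / (2 * real n + (\<alpha> + 1) + (\<beta> + 1) + 1) +
      (2 * real n + 1) / (2 * real n + (\<alpha> + 1) + (\<beta> + 1) + 1)) {0..1}"
    unfolding jacobi_energy.simps(2)[abs_def] using Suc.prems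
    by (intro has_integral_add has_integral_jacobi_sq Suc.IH) auto
  moreover have "1 / x + 1 / y + (2 * real n + 1) / y = (2 * real (Suc n) + 1) / x" if "y = x" for x y :: real
    by (simp add: that flip: add_divide_distrib)
  from this[of "2 * real n + (\<alpha> + 1) + (\<beta> + 1) + 1" "2 * real (Suc n) + \<alpha> + \<beta> + 1"]
  have "1 / (2 * real (Suc n) + \<alpha> + \<beta> + 1) + 1 / (2 * real n + (\<alpha> + 1) + (\<beta> + 1) + 1) +
      (2 * real n + 1) / (2 * real n + (\<alpha> + 1) + (\<beta> + 1) + 1) =
      (2 * real (Suc n) + 1) / (2 * real (Suc n) + \<alpha> + \<beta> + 1)"
    by simp
  ultimately show ?case
    by (simp only:)
qed

section \<open>Moments of u from integrating (f V)' for polynomial multipliers f\<close>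

lemma has_integral_mult_energy:
  assumes "\<alpha> \<ge> 0" "\<beta> \<ge> 0" "0 \<le> a" "a \<le> b" "b \<le> 1"
    and "\<And>t. (f has_real_derivative f' t) (at t)"
  shows "((\<lambda>t. f' t * jacobi_energy n \<alpha> \<beta> t + f t * (jacobi_sq n \<alpha> \<beta> t * (\<alpha> / t - \<beta> / (1 - t))))
    has_integral f b * jacobi_energy n \<alpha> \<beta> b - f a * jacobi_energy n \<alpha> \<beta> a) {a..b}"
proof (rule fundamental_theorem_of_calculus_interior)
  have "continuous_on {a..b} f"
    using assms(6) by (intro continuous_at_imp_continuous_on ballI DERIV_isCont)
  moreover have "continuous_on {a..b} (jacobi_energy n \<alpha> \<beta>)"
    using assms by (intro continuous_on_subset[OF continuous_on_jacobi_energy]) auto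
  ultimately show "continuous_on {a..b} (\<lambda>t. f t * jacobi_energy n \<alpha> \<beta> t)"
    by (intro continuous_intros)
  fix t assume "t \<in> {a<..<b}"
  then have "t \<in> {0<..<1}" using assms by auto
  from DERIV_mult[OF assms(6) has_real_derivative_jacobi_energy[OF assms(1,2) this]]
  show "((\<lambda>t. f t * jacobi_energy n \<alpha> \<beta> t) has_vector_derivative
      f' t * jacobi_energy n \<alpha> \<beta> t + f t * (jacobi_sq n \<alpha> \<beta> t * (\<alpha> / t - \<beta> / (1 - t)))) (at t)"
    by (simp add: has_real_derivative_iff_has_vector_derivative mult_ac)
qed (use assms in auto)

lemma has_integral_energy_derivative:
  assumes "\<alpha> \<ge> 0" "\<beta> \<ge> 0" "0 \<le> a" "a \<le> b" "b \<le> 1"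
  shows "((\<lambda>t. jacobi_sq n \<alpha> \<beta> t * (\<alpha> / t - \<beta> / (1 - t)))
    has_integral jacobi_energy n \<alpha> \<beta> b - jacobi_energy n \<alpha> \<beta> a) {a..b}"
  using has_integral_mult_energy[OF assms, of "\<lambda>_. 1" "\<lambda>_. 0"] by simp

text \<open>Since t \<phi> = \<alpha> + \<beta> - \<beta>/(1-t), the integrand is V +
  (\<alpha>+\<beta>) u - (t V)'. The first two terms have total mass 1, and t V vanishes at both
  ends.\<close>

lemma has_integral_jacobi_sq_div_right:
  assumes "\<alpha> > 0" "\<beta> > 0"
  shows "((\<lambda>t. jacobi_sq n \<alpha> \<beta> t * (\<beta> / (1 - t))) has_integral 1) {0..1}"
proof -
  let ?u = "jacobi_sq n \<alpha> \<beta>" and ?V = "jacobi_energy n \<alpha> \<beta>"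
  define M where "M = 2 * real n + \<alpha> + \<beta> + 1"
  have "M > 0" using assms by (simp add: M_def)
  have "((\<lambda>t. 1 * ?V t + t * (?u t * (\<alpha> / t - \<beta> / (1 - t)))) has_integral 1 * ?V 1 - 0 * ?V 0) {0..1}"
    using assms by (intro has_integral_mult_energy) (auto intro!: derivative_eq_intros)
  then have int: "((\<lambda>t. ?V t + (\<alpha> + \<beta>) * ?u t - (1 * ?V t + t * (?u t * (\<alpha> / t - \<beta> / (1 - t)))))
      has_integral (2 * real n + 1) / M + (\<alpha> + \<beta>) * (1 / M) - (1 * ?V 1 - 0 * ?V 0)) {0..1}"
    using assms unfolding M_def
    by (intro has_integral_diff has_integral_add has_integral_mult_right
        has_integral_jacobi_energy has_integral_jacobi_sq) auto
  have total: "(2 * real n + 1) / M + (\<alpha> + \<beta>) * (1 / M) - (1 * ?V 1 - 0 * ?V 0) = 1"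
    using assms \<open>M > 0\<close> by (simp add: jacobi_energy_1 M_def flip: add_divide_distrib)
  \<comment> \<open>At the endpoints u is 0, so both sides vanish there whatever value division by
    zero takes. Inside, the identity used is t a + (1-t) b = \<alpha> + \<beta> with a = \<alpha>/t
    and b = \<beta>/(1-t).\<close>
  have eq: "?V t + (\<alpha> + \<beta>) * ?u t - (1 * ?V t + t * (?u t * (\<alpha> / t - \<beta> / (1 - t)))) =
      ?u t * (\<beta> / (1 - t))" if t: "t \<in> {0..1}" for t
  proof -
    consider "t = 0" | "t = 1" | "t \<in> {0<..<1}" using t by fastforce
    then show ?thesis
    proof cases
      case 3
      have "(t * a + (1 - t) * b) * u - t * (u * (a - b)) = u * b" for u a b
        by (simp add: algebra_simps)
      from this[of "\<alpha> / t" "\<beta> / (1 - t)" "?u t"] 3 show ?thesis by simp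
    qed (use assms in \<open>simp_all add: jacobi_sq_0 jacobi_sq_1\<close>)
  qed
  show ?thesis
    using has_integral_eq[OF eq int] unfolding total .
qed

text \<open>The integral of u \<phi> = V' is 0 because V vanishes at both ends, so the two singular
  integrals agree.\<close>

lemma has_integral_jacobi_sq_div_left:
  assumes "\<alpha> > 0" "\<beta> > 0"
  shows "((\<lambda>t. jacobi_sq n \<alpha> \<beta> t * (\<alpha> / t)) has_integral 1) {0..1}"
proof -
  have "((\<lambda>t. jacobi_sq n \<alpha> \<beta> t * (\<alpha> / t - \<beta> / (1 - t)) + jacobi_sq n \<alpha> \<beta> t * (\<beta> / (1 - t)))
      has_integral (jacobi_energy n \<alpha> \<beta> 1 - jacobi_energy n \<alpha> \<beta> 0) + 1) {0..1}"
    using assms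
    by (intro has_integral_add has_integral_energy_derivative has_integral_jacobi_sq_div_right) auto
  moreover have "(\<lambda>t. jacobi_sq n \<alpha> \<beta> t * (\<alpha> / t - \<beta> / (1 - t)) + jacobi_sq n \<alpha> \<beta> t * (\<beta> / (1 - t))) =
      (\<lambda>t. jacobi_sq n \<alpha> \<beta> t * (\<alpha> / t))"
    by (simp add: fun_eq_iff right_diff_distrib)
  ultimately show ?thesis
    using assms by (simp add: jacobi_energy_0 jacobi_energy_1)
qed

text \<open>Integrates (t^2 V)' using t^2 \<phi> = (\<alpha>+\<beta>) t + \<beta> - \<beta>/(1-t). V
  is split into u and V - u, because V - u consists of squares of lower degree, whose moment r comes
  from an induction.\<close>

lemma has_integral_jacobi_sq_moment_step:
  assumes "\<alpha> > 0" "\<beta> > 0"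
    and R: "((\<lambda>t. t * (jacobi_energy n \<alpha> \<beta> t - jacobi_sq n \<alpha> \<beta> t)) has_integral r) {0..1}"
  shows "((\<lambda>t. t * jacobi_sq n \<alpha> \<beta> t) has_integral
    (1 - \<beta> / (2 * real n + \<alpha> + \<beta> + 1) - 2 * r) / (\<alpha> + \<beta> + 2)) {0..1}"
proof -
  let ?u = "jacobi_sq n \<alpha> \<beta>" and ?V = "jacobi_energy n \<alpha> \<beta>"
  have "((\<lambda>t. (2 * t) * ?V t + t\<^sup>2 * (?u t * (\<alpha> / t - \<beta> / (1 - t)))) has_integral
      1\<^sup>2 * ?V 1 - 0\<^sup>2 * ?V 0) {0..1}"
    using assms by (intro has_integral_mult_energy) (auto intro!: derivative_eq_intros)
  then have int: "((\<lambda>t. (?u t * (\<beta> / (1 - t)) - \<beta> * ?u t - 2 * (t * (?V t - ?u t)) +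
        ((2 * t) * ?V t + t\<^sup>2 * (?u t * (\<alpha> / t - \<beta> / (1 - t))))) / (\<alpha> + \<beta> + 2)) has_integral
      (1 - \<beta> * (1 / (2 * real n + \<alpha> + \<beta> + 1)) - 2 * r + (1\<^sup>2 * ?V 1 - 0\<^sup>2 * ?V 0)) / (\<alpha> + \<beta> + 2)) {0..1}"
    using assms
    by (intro has_integral_divide has_integral_add has_integral_diff has_integral_mult_right
        has_integral_jacobi_sq has_integral_jacobi_sq_div_right) auto
  have eq: "(?u t * (\<beta> / (1 - t)) - \<beta> * ?u t - 2 * (t * (?V t - ?u t)) +
        ((2 * t) * ?V t + t\<^sup>2 * (?u t * (\<alpha> / t - \<beta> / (1 - t))))) / (\<alpha> + \<beta> + 2) = t * ?u t"
    if t: "t \<in> {0..1}" for t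
  proof -
    have "?u t * (\<beta> / (1 - t)) - \<beta> * ?u t + t\<^sup>2 * (?u t * (\<alpha> / t - \<beta> / (1 - t))) = (\<alpha> + \<beta>) * (t * ?u t)"
    proof -
      consider "t = 0" | "t = 1" | "t \<in> {0<..<1}" using t by fastforce
      then show ?thesis
      proof cases
        case 3
        have "u * b - ((1 - t) * b) * u + t\<^sup>2 * (u * (a - b)) = (t * a + (1 - t) * b) * (t * u)" for u a b
          by (simp add: algebra_simps power2_eq_square)
        from this[of "?u t" "\<beta> / (1 - t)" "\<alpha> / t"] 3 show ?thesis by simp
      qed (use assms in \<open>simp_all add: jacobi_sq_0 jacobi_sq_1\<close>)
    qed
    then show ?thesis
      using assms by (simp add: field_simps)
  qed
  show ?thesis
    using has_integral_eq[OF eq int] assms by (simp add: jacobi_energy_1)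
qed

text \<open>M and \<beta>-\<alpha>, hence K, are invariant under the ladder step and stay fixed in
  the induction. Both moments are proved together, since the step for u needs the one for the lower
  energy. Relative to its mass 1/(M+1), u has mean 1/2 - K (\<alpha>+\<beta>), the diagonal
  coefficient of the three-term recurrence; summing over the ladder gives the energy.\<close>

lemma has_integral_jacobi_sq_energy_moment:
  assumes "\<alpha> > 0" "\<beta> > 0" "M = 2 * real n + \<alpha> + \<beta>" "2 * M * (M + 2) * K = \<beta> - \<alpha>"
  shows "((\<lambda>t. t * jacobi_sq n \<alpha> \<beta> t) has_integral (1 / 2 - K * (\<alpha> + \<beta>)) / (M + 1)) {0..1} \<and>
    ((\<lambda>t. t * jacobi_energy n \<alpha> \<beta> t) has_integral
      ((2 * real n + 1) / 2 - K * ((2 * real n + 1) * (\<alpha> + \<beta>) + 2 * real n * (real n + 1))) / (M + 1)) {0..1}"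
  using assms
proof (induction n arbitrary: \<alpha> \<beta>)
  case 0
  have "((\<lambda>t. t * jacobi_sq 0 \<alpha> \<beta> t) has_integral
      (1 - \<beta> / (2 * real 0 + \<alpha> + \<beta> + 1) - 2 * 0) / (\<alpha> + \<beta> + 2)) {0..1}"
    using 0 by (intro has_integral_jacobi_sq_moment_step) auto
  moreover have "(1 - \<beta> / (2 * real 0 + \<alpha> + \<beta> + 1) - 2 * 0) / (\<alpha> + \<beta> + 2) =
      (1 / 2 - K * (\<alpha> + \<beta>)) / (M + 1)"
  proof -
    have M: "M = \<alpha> + \<beta>" "M + 1 > 0" "M + 2 > 0" using 0 by auto
    have "2 * ((1 / 2 - K * M) * (M + 2)) = M + 2 - (\<beta> - \<alpha>)"
      unfolding 0(4)[symmetric] by (simp add: algebra_simps)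
    then have "1 / 2 - K * M = (\<alpha> + 1) / (M + 2)"
      using M by (simp add: eq_divide_eq)
    moreover have "1 - \<beta> / (M + 1) = (\<alpha> + 1) / (M + 1)"
      using M by (simp add: field_simps)
    ultimately show ?thesis
      using M by (simp add: mult.commute)
  qed
  ultimately show ?case
    by simp
next
  case (Suc n)
  define s where "s = \<alpha> + \<beta>"
  define m where "m = real n"
  have M: "M + 1 > 0" "M = 2 * m + 2 + s" and s: "s + 2 > 0"
    using Suc.prems by (auto simp: s_def m_def)
  \<comment> \<open>The moment of V - u, as the sum of the two induction hypotheses, where s + 2 is
    the raised parameter sum.\<close>
  define r where "r = (m + 1 - K * ((2 * m + 2) * (s + 2) + 2 * m * (m + 1))) / (M + 1)"
  have IH: "((\<lambda>t. t * jacobi_sq n (\<alpha> + 1) (\<beta> + 1) t) has_integral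
      (1 / 2 - K * (\<alpha> + 1 + (\<beta> + 1))) / (M + 1)) {0..1}"
    "((\<lambda>t. t * jacobi_energy n (\<alpha> + 1) (\<beta> + 1) t) has_integral
      ((2 * real n + 1) / 2 - K * ((2 * real n + 1) * (\<alpha> + 1 + (\<beta> + 1)) + 2 * real n * (real n + 1))) / (M + 1)) {0..1}"
    using Suc.IH[of "\<alpha> + 1" "\<beta> + 1"] Suc.prems by auto
  have rest: "((\<lambda>t. t * (jacobi_energy (Suc n) \<alpha> \<beta> t - jacobi_sq (Suc n) \<alpha> \<beta> t)) has_integral r) {0..1}"
  proof -
    have "(1 / 2 - K * (\<alpha> + 1 + (\<beta> + 1))) / (M + 1) +
      ((2 * real n + 1) / 2 - K * ((2 * real n + 1) * (\<alpha> + 1 + (\<beta> + 1)) + 2 * real n * (real n + 1))) / (M + 1) = r"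
      unfolding r_def s_def m_def add_divide_distrib[symmetric]
    by (rule arg_cong[of _ _ "\<lambda>x. x / (M + 1)"]) (simp add: field_simps)
    with has_integral_add[OF IH] show ?thesis
      by (simp add: distrib_left)
  qed
  have "((\<lambda>t. t * jacobi_sq (Suc n) \<alpha> \<beta> t) has_integral
      (1 - \<beta> / (2 * real (Suc n) + \<alpha> + \<beta> + 1) - 2 * r) / (\<alpha> + \<beta> + 2)) {0..1}"
    using Suc.prems rest by (intro has_integral_jacobi_sq_moment_step) auto
  moreover have "(1 - \<beta> / (2 * real (Suc n) + \<alpha> + \<beta> + 1) - 2 * r) / (\<alpha> + \<beta> + 2) =
      (1 / 2 - K * (\<alpha> + \<beta>)) / (M + 1)"
  proof -
    \<comment> \<open>Writing 2\<beta> = (\<alpha>+\<beta>) + (\<beta>-\<alpha>) brings in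
      K.\<close>
    have "2 * \<beta> = s + 2 * M * (M + 2) * K"
      using Suc.prems by (simp add: s_def)
    moreover have "r * (M + 1) = m + 1 - K * ((2 * m + 2) * (s + 2) + 2 * m * (m + 1))"
      using M(1) by (simp add: r_def)
    ultimately have "2 * ((M + 1) - \<beta> - 2 * (r * (M + 1))) = 2 * ((1 / 2 - K * s) * (s + 2))"
      unfolding M(2) by algebra
    then have "(M + 1) - \<beta> - 2 * (r * (M + 1)) = (1 / 2 - K * s) * (s + 2)"
      by (metis mult_left_cancel zero_neq_numeral)
    moreover have "1 - \<beta> / (M + 1) - 2 * r = ((M + 1) - \<beta> - 2 * (r * (M + 1))) / (M + 1)"
      using M(1) by (simp add: field_simps)
    ultimately have "(1 - \<beta> / (M + 1) - 2 * r) / (s + 2) = (1 / 2 - K * s) / (M + 1)"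
      using s by simp
    then show ?thesis
      using Suc.prems(3) by (simp add: s_def add.assoc)
  qed
  ultimately have sq: "((\<lambda>t. t * jacobi_sq (Suc n) \<alpha> \<beta> t) has_integral (1 / 2 - K * (\<alpha> + \<beta>)) / (M + 1)) {0..1}"
    by simp
  have "(1 / 2 - K * (\<alpha> + \<beta>)) / (M + 1) + r =
      ((2 * real (Suc n) + 1) / 2 - K * ((2 * real (Suc n) + 1) * (\<alpha> + \<beta>) +
        2 * real (Suc n) * (real (Suc n) + 1))) / (M + 1)"
    unfolding r_def s_def m_def add_divide_distrib[symmetric]
    by (rule arg_cong[of _ _ "\<lambda>x. x / (M + 1)"]) (simp add: field_simps)
  moreover have "(\<lambda>t. t * jacobi_sq (Suc n) \<alpha> \<beta> t +
      t * (jacobi_energy (Suc n) \<alpha> \<beta> t - jacobi_sq (Suc n) \<alpha> \<beta> t)) = (\<lambda>t. t * jacobi_energy (Suc n) \<alpha> \<beta> t)"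
    by (simp add: fun_eq_iff distrib_left right_diff_distrib)
  ultimately show ?case
    using has_integral_add[OF sq rest] sq by (simp only:)
qed

section \<open>The bound\<close>

text \<open>If \<beta> = 0, then \<phi> = \<alpha>/t makes V increasing, and (t V)' = V + \<alpha> u
  has integral 1, so V(1) = 1. The case \<alpha> = 0 is the mirror image, with multiplier 1 - t and
  maximum at 0.\<close>

lemma jacobi_energy_le_1:
  assumes "\<alpha> \<ge> 0" "\<beta> \<ge> 0" "\<alpha> = 0 \<or> \<beta> = 0" "t \<in> {0..1}"
  shows "jacobi_energy n \<alpha> \<beta> t \<le> 1"
proof -
  let ?u = "jacobi_sq n \<alpha> \<beta>" and ?V = "jacobi_energy n \<alpha> \<beta>"
  define M where "M = 2 * real n + \<alpha> + \<beta> + 1"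
  have "M > 0" using assms by (simp add: M_def)
  have total: "((\<lambda>t. ?V t + (\<alpha> + \<beta>) * ?u t) has_integral 1) {0..1}"
  proof -
    have "((\<lambda>t. ?V t + (\<alpha> + \<beta>) * ?u t) has_integral (2 * real n + 1) / M + (\<alpha> + \<beta>) * (1 / M)) {0..1}"
      using assms(1,2) unfolding M_def
      by (intro has_integral_add has_integral_mult_right has_integral_jacobi_energy has_integral_jacobi_sq) auto
    moreover have "(2 * real n + 1) / M + (\<alpha> + \<beta>) * (1 / M) = 1"
      using \<open>M > 0\<close> by (simp add: M_def flip: add_divide_distrib)
    ultimately show ?thesis by simp
  qed
  show ?thesis
  proof (cases "\<beta> = 0")
    case True
    have "((\<lambda>t. 1 * ?V t + t * (?u t * (\<alpha> / t - \<beta> / (1 - t)))) has_integral 1 * ?V 1 - 0 * ?V 0) {0..1}"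
      using assms by (intro has_integral_mult_energy) (auto intro!: derivative_eq_intros)
    \<comment> \<open>t (\<alpha>/t) = \<alpha> fails only at t = 0, where division by zero yields
      0.\<close>
    then have "((\<lambda>t. ?V t + (\<alpha> + \<beta>) * ?u t) has_integral 1 * ?V 1 - 0 * ?V 0) {0..1}"
      by (rule has_integral_spike_finite[rotated 2, of _ _ _ "{0}"]) (auto simp: True)
    from has_integral_unique[OF total this] have "?V 1 = 1"
      by simp
    moreover have "0 \<le> ?V 1 - ?V t"
      using assms True jacobi_sq_nonneg[OF assms(1,2)]
      by (intro has_integral_nonneg[OF has_integral_energy_derivative[of \<alpha> \<beta> t 1 n]]) auto
    ultimately show ?thesis by simp
  next
    case False
    with assms have "\<alpha> = 0" by simp
    have "((\<lambda>t. (-1) * ?V t + (1 - t) * (?u t * (\<alpha> / t - \<beta> / (1 - t)))) has_integral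
        (1 - 1) * ?V 1 - (1 - 0) * ?V 0) {0..1}"
      using assms by (intro has_integral_mult_energy) (auto intro!: derivative_eq_intros)
    from has_integral_neg[OF this]
    have "((\<lambda>t. ?V t + (\<alpha> + \<beta>) * ?u t) has_integral - ((1 - 1) * ?V 1 - (1 - 0) * ?V 0)) {0..1}"
      by (rule has_integral_spike_finite[rotated 2, of _ _ _ "{1}"]) (auto simp: \<open>\<alpha> = 0\<close>)
    from has_integral_unique[OF total this] have "?V 0 = 1"
      by simp
    moreover have "0 \<le> - (?V t - ?V 0)"
      using assms \<open>\<alpha> = 0\<close> jacobi_sq_nonneg[OF assms(1,2)]
      by (intro has_integral_nonneg[OF has_integral_neg[OF has_integral_energy_derivative[of \<alpha> \<beta> 0 t n]]]) auto
    ultimately show ?thesis by simp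
  qed
qed

text \<open>Here y is the mean of Y = \<alpha> (1-t) + \<beta> t under the density (M+1) u. The
  second claim turns the Jensen term 1/y into the denominator of the final bound.\<close>

lemma jacobi_mean_bound:
  fixes \<alpha> \<beta> :: real and n :: nat
  assumes "\<alpha> > 0" "\<beta> > 0"
  defines "M \<equiv> 2 * real n + \<alpha> + \<beta>"
  defines "y \<equiv> (\<alpha> + \<beta>) / 2 * (1 - (\<beta> - \<alpha>)\<^sup>2 / (M * (M + 2)))"
  shows "y > 0" and "(M + 1) * y \<le> 2 * ((real n + \<alpha> + 1) * (real n + \<beta> + 1))"
proof -
  define d where "d = \<beta> - \<alpha>"
  define z where "z = 1 - d\<^sup>2 / (M * (M + 2))"
  have M: "M > 0" "\<alpha> + \<beta> \<le> M" using assms by (auto simp: M_def)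
  have "\<bar>d\<bar> \<le> M" using assms by (auto simp: d_def)
  then have d: "d\<^sup>2 \<le> M\<^sup>2" using M by (simp add: abs_le_square_iff[symmetric])
  also have "M\<^sup>2 < M * (M + 2)" using M by (simp add: power2_eq_square algebra_simps)
  finally have z: "z > 0" using M by (simp add: z_def divide_less_eq_1_pos)
  have y: "y = (\<alpha> + \<beta>) / 2 * z" by (simp add: y_def z_def d_def)
  then show "y > 0" using z assms by simp
  \<comment> \<open>Replacing \<alpha>+\<beta> by M leaves a comparison with (M+2)^2 -
    (\<beta>-\<alpha>)^2, which is four times the product on the right.\<close>
  have "(M + 1) * y \<le> (M + 1) * (M / 2 * z)"
    unfolding y using M z by (intro mult_left_mono mult_right_mono) auto
  also have "\<dots> = ((M + 1) * M - d\<^sup>2 + d\<^sup>2 / (M + 2)) / 2"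
  proof -
    define e where "e = d\<^sup>2 / (M + 2)"
    have z_eq: "M * z = M - e" using M by (simp add: z_def e_def right_diff_distrib)
    have d_eq: "d\<^sup>2 = e * (M + 2)" using M by (simp add: e_def)
    have "(M + 1) * (M / 2 * z) = (M + 1) * (M * z) / 2" by simp
    also have "\<dots> = ((M + 1) * M - d\<^sup>2 + e) / 2"
      unfolding z_eq d_eq by (simp add: algebra_simps)
    finally show ?thesis unfolding e_def .
  qed
  also have "\<dots> \<le> ((M + 2)\<^sup>2 - d\<^sup>2) / 2"
  proof -
    have "d\<^sup>2 / (M + 2) \<le> M" using d M by (simp add: field_simps power2_eq_square)
    moreover have "(M + 2)\<^sup>2 = (M + 1) * M + 3 * M + 4" by (simp add: power2_eq_square algebra_simps)
    ultimately have "(M + 1) * M - d\<^sup>2 + d\<^sup>2 / (M + 2) \<le> (M + 2)\<^sup>2 - d\<^sup>2"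
      using M by linarith
    then show ?thesis by (rule divide_right_mono) simp
  qed
  also have "\<dots> = 2 * ((real n + \<alpha> + 1) * (real n + \<beta> + 1))"
    by (simp add: M_def d_def power2_eq_square field_simps)
  finally show "(M + 1) * y \<le> 2 * ((real n + \<alpha> + 1) * (real n + \<beta> + 1))" .
qed

text \<open>With \<open>\<omega> = \<alpha>/t + \<beta>/(1-t)\<close> and \<open>\<phi> = \<alpha>/t - \<beta>/(1-t)\<close> one has
  \<open>\<phi>\<^sup>2/\<omega> = \<omega> - 4\<alpha>\<beta>/Y\<close> for \<open>Y = \<alpha>(1-t) + \<beta>t\<close>. The bound is AM-GM for \<open>\<bar>\<phi>\<bar>\<close> against \<open>\<lambda>\<omega>\<close>,
  with \<open>1/Y\<close> replaced by its tangent line at \<open>y\<close>.\<close>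

lemma abs_log_derivative_le:
  fixes \<alpha> \<beta> t l y :: real
  assumes "\<alpha> > 0" "\<beta> > 0" "t \<in> {0<..<1}" "l > 0" "y > 0"
  shows "\<bar>\<alpha> / t - \<beta> / (1 - t)\<bar> \<le> (l * (\<alpha> / t + \<beta> / (1 - t)) +
    (\<alpha> / t + \<beta> / (1 - t) - 4 * \<alpha> * \<beta> * (2 / y - (\<alpha> + (\<beta> - \<alpha>) * t) / y\<^sup>2)) / l) / 2"
proof -
  define w where "w = \<alpha> / t + \<beta> / (1 - t)"
  define p where "p = \<alpha> / t - \<beta> / (1 - t)"
  define Y where "Y = \<alpha> + (\<beta> - \<alpha>) * t"
  have "Y = \<alpha> * (1 - t) + \<beta> * t" by (simp add: Y_def algebra_simps)
  then have Y: "Y > 0" using assms by (simp add: add_pos_pos)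
  have w: "w > 0" using assms by (simp add: w_def add_pos_pos)
  have wY: "w * (t * (1 - t)) = Y" using assms by (simp add: w_def Y_def field_simps)
  have "(w\<^sup>2 - p\<^sup>2) * (t * (1 - t)) = 4 * \<alpha> * \<beta>"
  proof -
    have "((a + b)\<^sup>2 - (a - b)\<^sup>2) * (t * (1 - t)) = 4 * (a * t) * (b * (1 - t))" for a b
      by (simp add: power2_eq_square algebra_simps)
    from this[of "\<alpha> / t" "\<beta> / (1 - t)"] show ?thesis
      using assms by (simp add: w_def p_def)
  qed
  then have "(w\<^sup>2 - p\<^sup>2) * Y = w * (4 * \<alpha> * \<beta>)"
    unfolding wY[symmetric] by algebra
  then have p2: "p\<^sup>2 = w * (w - 4 * \<alpha> * \<beta> / Y)"
    using Y by (simp add: field_simps power2_eq_square)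
  \<comment> \<open>The gap between the convex function 1/Y and its tangent at y.\<close>
  have "0 \<le> (Y - y)\<^sup>2 / (Y * y\<^sup>2)" using Y by simp
  also have "\<dots> = 1 / Y - (2 / y - Y / y\<^sup>2)"
    using Y assms by (simp add: field_simps power2_eq_square)
  finally have "4 * \<alpha> * \<beta> * (2 / y - Y / y\<^sup>2) \<le> 4 * \<alpha> * \<beta> * (1 / Y)"
    using assms by (intro mult_left_mono) auto
  then have tangent: "w - 4 * \<alpha> * \<beta> / Y \<le> w - 4 * \<alpha> * \<beta> * (2 / y - Y / y\<^sup>2)" by simp
  \<comment> \<open>AM-GM; after division by w > 0, the term p^2/w becomes w -
    4\<alpha>\<beta>/Y.\<close>
  have "0 \<le> (l * w - \<bar>p\<bar>)\<^sup>2" by simp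
  also have "\<dots> = l\<^sup>2 * w\<^sup>2 - 2 * l * w * \<bar>p\<bar> + p\<^sup>2"
    by (simp add: power2_diff power_mult_distrib)
  finally have "w * (2 * l * \<bar>p\<bar>) \<le> w * (l\<^sup>2 * w + (w - 4 * \<alpha> * \<beta> / Y))"
    unfolding p2 by (simp add: power2_eq_square algebra_simps)
  then have "2 * l * \<bar>p\<bar> \<le> l\<^sup>2 * w + (w - 4 * \<alpha> * \<beta> * (2 / y - Y / y\<^sup>2))"
    using w tangent by simp
  then have "\<bar>p\<bar> \<le> (l * w + (w - 4 * \<alpha> * \<beta> * (2 / y - Y / y\<^sup>2)) / l) / 2"
    using assms(4) by (simp add: field_simps power2_eq_square)
  then show ?thesis by (simp add: w_def p_def Y_def)
qed

text \<open>As V vanishes at both ends, 2 V(t) is the integral of V' over [0,t] minus that over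
  [t,1]. Both are dominated by integrals of the same majorant u k. The Cauchy-Schwarz inequality
  enters as AM-GM with a fixed multiplier l.\<close>

lemma jacobi_energy_bound:
  assumes "\<alpha> > 0" "\<beta> > 0" "t \<in> {0..1}"
  shows "jacobi_energy n \<alpha> \<beta> t \<le> sqrt ((real n + 1) * (real n + \<alpha> + \<beta> + 1) /
    ((real n + \<alpha> + 1) * (real n + \<beta> + 1)))"
proof -
  let ?u = "jacobi_sq n \<alpha> \<beta>" and ?V = "jacobi_energy n \<alpha> \<beta>"
  define M where "M = 2 * real n + \<alpha> + \<beta>"
  define y where "y = (\<alpha> + \<beta>) / 2 * (1 - (\<beta> - \<alpha>)\<^sup>2 / (M * (M + 2)))"
  define D where "D = (real n + \<alpha> + 1) * (real n + \<beta> + 1)"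
  \<comment> \<open>The multiplier is the target bound itself: l^2 = 1 - \<alpha>\<beta>/D dominates
    the second half of the integral, so the total is at most l + l^2/l = 2 l.\<close>
  define l where "l = sqrt ((real n + 1) * (real n + \<alpha> + \<beta> + 1) / D)"
  define K where "K = (\<beta> - \<alpha>) / (M * (M + 2)) / 2"
  define I where "I = (1 / 2 - K * (\<alpha> + \<beta>)) / (M + 1)"
  define k where "k = (\<lambda>t. (l * (\<alpha> / t + \<beta> / (1 - t)) +
    (\<alpha> / t + \<beta> / (1 - t) - 4 * \<alpha> * \<beta> * (2 / y - (\<alpha> + (\<beta> - \<alpha>) * t) / y\<^sup>2)) / l) / 2)"
  have M: "M > 0" and D: "D > 0" using assms by (simp_all add: M_def D_def)
  have l: "l > 0" unfolding l_def using assms D by simp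
  have y: "y > 0" "(M + 1) * y \<le> 2 * D"
    unfolding y_def M_def D_def by (rule jacobi_mean_bound[OF assms(1,2)])+
  have l2: "l\<^sup>2 = 1 - \<alpha> * \<beta> / D"
  proof -
    have "l\<^sup>2 = (real n + 1) * (real n + \<alpha> + \<beta> + 1) / D"
      unfolding l_def using assms D by (intro real_sqrt_pow2) simp
    also have "\<dots> = (D - \<alpha> * \<beta>) / D"
      by (simp add: D_def algebra_simps)
    finally show ?thesis
      using D by (simp add: diff_divide_distrib)
  qed
  \<comment> \<open>The mean of \<alpha> + (\<beta>-\<alpha>) t is y, which is why the tangent of
    1/Y is taken there.\<close>
  have moment: "\<alpha> * (1 / (M + 1)) + (\<beta> - \<alpha>) * I = y / (M + 1)"
  proof -
    have "(\<beta> - \<alpha>)\<^sup>2 / (M * (M + 2)) = (\<beta> - \<alpha>) * ((\<beta> - \<alpha>) / (M * (M + 2)))"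
      by (simp add: power2_eq_square)
    also have "(\<beta> - \<alpha>) / (M * (M + 2)) = 2 * K"
      unfolding K_def by (rule field_sum_of_halves[unfolded mult_2[symmetric], symmetric])
    finally have sq: "(\<beta> - \<alpha>)\<^sup>2 / (M * (M + 2)) = 2 * (\<beta> - \<alpha>) * K"
      by simp
    have "\<alpha> + (\<beta> - \<alpha>) * (1 / 2 - K * (\<alpha> + \<beta>)) = y"
      unfolding y_def sq by (simp add: field_simps)
    then show ?thesis
      by (simp add: I_def flip: add_divide_distrib)
  qed
  have "2 * M * (M + 2) * K = \<beta> - \<alpha>"
    using M by (simp add: K_def)
  then have moment_int: "((\<lambda>t. t * ?u t) has_integral I) {0..1}"
    unfolding I_def using has_integral_jacobi_sq_energy_moment[OF assms(1,2) M_def] by blast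
  have mass_int: "(?u has_integral 1 / (M + 1)) {0..1}"
    unfolding M_def using assms by (intro has_integral_jacobi_sq) auto
  have "((\<lambda>t. (l * (?u t * (\<alpha> / t) + ?u t * (\<beta> / (1 - t))) +
      (?u t * (\<alpha> / t) + ?u t * (\<beta> / (1 - t)) - 4 * \<alpha> * \<beta> *
        (2 / y * ?u t - (\<alpha> * ?u t + (\<beta> - \<alpha>) * (t * ?u t)) / y\<^sup>2)) / l) / 2) has_integral
      (l * (1 + 1) + (1 + 1 - 4 * \<alpha> * \<beta> * (2 / y * (1 / (M + 1)) -
        (\<alpha> * (1 / (M + 1)) + (\<beta> - \<alpha>) * I) / y\<^sup>2)) / l) / 2) {0..1}" (is "(?f has_integral ?c) _")
    using assms(1,2)
    by (intro has_integral_add has_integral_diff has_integral_mult_right has_integral_divide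
        has_integral_jacobi_sq_div_left has_integral_jacobi_sq_div_right moment_int mass_int) auto
  moreover have "?f = (\<lambda>t. ?u t * k t)"
    by (simp add: k_def fun_eq_iff algebra_simps add_divide_distrib diff_divide_distrib)
  ultimately have int: "((\<lambda>t. ?u t * k t) has_integral ?c) {0..1}"
    by simp
  have "?c \<le> 2 * l"
  proof -
    have "?c = l + (1 - 2 * \<alpha> * \<beta> / (y * (M + 1))) / l"
    proof -
      \<comment> \<open>At the mean point the tangent line takes the value 1/y; this is Jensen's
        inequality for 1/Y.\<close>
      have "2 / y * a - y * a / y\<^sup>2 = a / y" for a
        using y(1) by (simp add: field_simps power2_eq_square)
      from this[of "1 / (M + 1)"]
      have "2 / y * (1 / (M + 1)) - y / (M + 1) / y\<^sup>2 = 1 / (y * (M + 1))"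
        by (simp add: mult.commute)
      then show ?thesis
        unfolding moment by (simp add: field_simps)
    qed
    also have "\<dots> \<le> l + (1 - \<alpha> * \<beta> / D) / l"
    proof -
      have "\<alpha> * \<beta> / D = 2 * \<alpha> * \<beta> / (2 * D)" by simp
      also have "\<dots> \<le> 2 * \<alpha> * \<beta> / (y * (M + 1))"
        using y M D assms by (intro divide_left_mono) (auto simp: mult.commute)
      finally show ?thesis
        using l by (simp add: divide_right_mono)
    qed
    also have "\<dots> = 2 * l"
      using l unfolding l2[symmetric] by (simp add: power2_eq_square)
    finally show ?thesis .
  qed
  have bound: "\<bar>?u s * (\<alpha> / s - \<beta> / (1 - s))\<bar> \<le> ?u s * k s" if s: "s \<in> {0..1}" for s
  proof -
    consider "s = 0" | "s = 1" | "s \<in> {0<..<1}" using s by fastforce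
    then show ?thesis
    proof cases
      case 3
      have u: "?u s \<ge> 0"
        using jacobi_sq_nonneg[of \<alpha> \<beta> s n] assms s by simp
      have "\<bar>\<alpha> / s - \<beta> / (1 - s)\<bar> \<le> k s"
        unfolding k_def by (rule abs_log_derivative_le[OF assms(1,2) 3 l y(1)])
      from mult_left_mono[OF this u] u show ?thesis
        by (simp add: abs_mult)
    qed (use assms in \<open>simp_all add: jacobi_sq_0 jacobi_sq_1\<close>)
  qed
  have integrable: "(\<lambda>t. ?u t * k t) integrable_on {0..t}" "(\<lambda>t. ?u t * k t) integrable_on {t..1}"
    using int assms(3) by (auto intro: integrable_on_subinterval[of _ "{0..1}"])
  \<comment> \<open>The left piece uses the upper bound for V', the right piece the upper bound for
    -V'; adding them recovers the full integral of the majorant.\<close>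
  have "?V t - ?V 0 \<le> integral {0..t} (\<lambda>t. ?u t * k t)"
  proof (rule has_integral_le[OF has_integral_energy_derivative integrable_integral[OF integrable(1)]])
    fix s assume "s \<in> {0..t}"
    then show "?u s * (\<alpha> / s - \<beta> / (1 - s)) \<le> ?u s * k s"
      using bound[of s] assms(3) by auto
  qed (use assms in auto)
  moreover have "- (?V 1 - ?V t) \<le> integral {t..1} (\<lambda>t. ?u t * k t)"
  proof (rule has_integral_le[OF has_integral_neg[OF has_integral_energy_derivative]
        integrable_integral[OF integrable(2)]])
    fix s assume "s \<in> {t..1}"
    then show "- (?u s * (\<alpha> / s - \<beta> / (1 - s))) \<le> ?u s * k s"
      using bound[of s] assms(3) by auto
  qed (use assms in auto)
  moreover have "integral {0..t} (\<lambda>t. ?u t * k t) + integral {t..1} (\<lambda>t. ?u t * k t) = ?c"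
    using int assms(3) by (subst Henstock_Kurzweil_Integration.integral_combine) (auto simp: integral_unique)
  ultimately have "2 * ?V t \<le> 2 * l"
    using \<open>?c \<le> 2 * l\<close> assms by (simp add: jacobi_energy_0 jacobi_energy_1)
  then show ?thesis
    by (simp add: l_def D_def)
qed

theorem theorem1p1:
  fixes n :: nat and \<alpha> \<beta> x :: real
  assumes "\<alpha> \<ge> 0" and "\<beta> \<ge> 0" and "x \<in> {-1..1}"
  shows "\<bar>jacobi_g n \<alpha> \<beta> x\<bar> \<le>
    root 4 ((real n + 1) * (real n + \<alpha> + \<beta> + 1) /
            ((real n + \<alpha> + 1) * (real n + \<beta> + 1)))"
proof -
  define q where "q = (real n + 1) * (real n + \<alpha> + \<beta> + 1) / ((real n + \<alpha> + 1) * (real n + \<beta> + 1))"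
  define t where "t = (1 - x) / 2"
  have t: "t \<in> {0..1}" using assms by (simp add: t_def)
  have "jacobi_energy n \<alpha> \<beta> t \<le> sqrt q"
  proof (cases "\<alpha> = 0 \<or> \<beta> = 0")
    case True
    \<comment> \<open>With a vanishing parameter the numerator and denominator coincide.\<close>
    then have "q = 1" using assms by (auto simp: q_def)
    then show ?thesis
      using jacobi_energy_le_1[OF assms(1,2) True t] by simp
  next
    case False
    then show ?thesis
      using jacobi_energy_bound[of \<alpha> \<beta> t n] assms t by (simp add: q_def)
  qed
  then have "(jacobi_g n \<alpha> \<beta> x)\<^sup>2 \<le> sqrt q"
    using jacobi_sq_le_energy[OF assms(1,2) t, of n] jacobi_g_square[OF assms, of n]
    by (simp add: t_def)
  then have "sqrt ((jacobi_g n \<alpha> \<beta> x)\<^sup>2) \<le> sqrt (sqrt q)"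
    by (rule real_sqrt_le_mono)
  then have "\<bar>jacobi_g n \<alpha> \<beta> x\<bar> \<le> sqrt (sqrt q)" by simp
  also have "sqrt (sqrt q) = root 4 q"
    using real_root_mult_exp[of 2 2 q] by (simp add: sqrt_def)
  finally show ?thesis by (simp add: q_def)
qed

end
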